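(* Let $n\ge 2$, let $(Q,T,\alpha)$ be an $n$-ary $f$-shelf (respectively, an $n$-ary $f$-rack, an $n$-ary $f$-quandle), and let $\beta:Q\to Q$ be a shelf morphism, i.e. a map such that $\beta(T(x_1,\dots,x_n))=T(\beta(x_1),\dots,\beta(x_n))$ for all $x_1,\dots,x_n\in Q$ and $\beta\circ\alpha=\alpha\circ\beta$. Then $(Q,\beta\circ T,\beta\circ\alpha)$ is an $n$-ary $f$-shelf (respectively, an $n$-ary $f$-rack, an $n$-ary $f$-quandle).
   Context: Let $Q$ be a set, $T:Q^{\times n}\to Q$ an $n$-ary operation, and $\alpha:Q\to Q$ a morphism, i.e. $\alpha(T(x_1,\dots,x_n))=T(\alpha(x_1),\dots,\alpha(x_n))$ for all $x_i\in Q$. Consider the conditions: (I) ($f$-distributivity) for all $x_1,\dots,x_n,u_1,\dots,u_{n-1}\in Q$, $$T(T(x_1,\dots,x_n),\alpha(u_1),\dots,\alpha(u_{n-1}))=T\big(T(x_1,u_1,\dots,u_{n-1}),T(x_2,u_1,\dots,u_{n-1}),\dots,T(x_n,u_1,\dots,u_{n-1})\big);$$ (II) for all $a_1,\dots,a_{n-1}\in Q$, the map $R_{a_1,\dots,a_{n-1}}:Q\to Q$, $R_{a_1,\dots,a_{n-1}}(x)=T(x,a_1,\dots,a_{n-1})$, is invertible; (III) for all $x\in Q$, $T(x,\dots,x)=\alpha(x)$. The triple $(Q,T,\alpha)$ is an $n$-ary $f$-shelf if (I) holds, an $n$-ary $f$-rack if (I) and (II) hold, and an $n$-ary $f$-quandle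 if (I), (II) and (III) hold.
   Formalization: In the rack and quandle cases β is additionally assumed bijective on Q, since otherwise the claim fails (e.g. a constant β on the two-element projection quandle T(x_1,…,x_n)=x_1, α=id); the shelf case is unchanged. *)

theory Defs
  imports Main
begin

text \<open>
  Elements of \<open>Q\<^sup>k\<close> are lists of length \<open>k\<close> with entries in the carrier \<open>Q\<close>, so that an
  \<open>n\<close>-ary operation is a function on lists of which only the values on \<open>tuples Q n\<close> matter.
\<close>

definition tuples :: "'a set \<Rightarrow> nat \<Rightarrow> 'a list set" where
  "tuples Q k = {xs. set xs \<subseteq> Q \<and> length xs = k}"

definition op_morphism :: "nat \<Rightarrow> 'a set \<Rightarrow> ('a list \<Rightarrow> 'a) \<Rightarrow> ('a \<Rightarrow> 'a) \<Rightarrow> bool" where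
  "op_morphism n Q T \<phi> \<longleftrightarrow>
     \<phi> ` Q \<subseteq> Q \<and> (\<forall>xs \<in> tuples Q n. \<phi> (T xs) = T (map \<phi> xs))"

locale nary_f_shelf =
  fixes n :: nat
    and Q :: "'a set"
    and T :: "'a list \<Rightarrow> 'a"
    and \<alpha> :: "'a \<Rightarrow> 'a"
  assumes op_closed: "xs \<in> tuples Q n \<Longrightarrow> T xs \<in> Q"
    and twist_morphism: "op_morphism n Q T \<alpha>"
    and f_distributive:
      "\<lbrakk>xs \<in> tuples Q n; us \<in> tuples Q (n - 1)\<rbrakk>
         \<Longrightarrow> T (T xs # map \<alpha> us) = T (map (\<lambda>x. T (x # us)) xs)"

locale nary_f_rack = nary_f_shelf +
  assumes right_mult_bij:
    "as \<in> tuples Q (n - 1) \<Longrightarrow> bij_betw (\<lambda>x. T (x # as)) Q Q"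

locale nary_f_quandle = nary_f_rack +
  assumes diagonal: "x \<in> Q \<Longrightarrow> T (replicate n x) = \<alpha> x"

definition shelf_morphism ::
    "nat \<Rightarrow> 'a set \<Rightarrow> ('a list \<Rightarrow> 'a) \<Rightarrow> ('a \<Rightarrow> 'a) \<Rightarrow> ('a \<Rightarrow> 'a) \<Rightarrow> bool" where
  "shelf_morphism n Q T \<alpha> \<beta> \<longleftrightarrow>
     op_morphism n Q T \<beta> \<and> (\<forall>x \<in> Q. (\<beta> \<circ> \<alpha>) x = (\<alpha> \<circ> \<beta>) x)"

text \<open>
  Twisting by a shelf morphism \<open>\<beta>\<close> that is not bijective need not preserve racks or quandles,
  since the right multiplications of \<open>\<beta> \<circ> T\<close> are \<open>\<beta> \<circ> R\<close> with \<open>R\<close> bijective. The projection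
  quandle with a constant \<open>\<beta>\<close> is a counterexample for every arity \<open>n \<ge> 2\<close>.
\<close>

lemma constant_twist_not_rack:
  assumes "n \<ge> 2"
  shows "nary_f_quandle n (UNIV :: bool set) hd id"
    and "shelf_morphism n (UNIV :: bool set) hd id (\<lambda>_. True)"
    and "\<not> nary_f_rack n (UNIV :: bool set) ((\<lambda>_. True) \<circ> hd) ((\<lambda>_. True) \<circ> id)"
proof -
  have ne: "xs \<noteq> []" if "xs \<in> tuples (UNIV :: bool set) n" for xs
    using that assms by (auto simp: tuples_def)
  show "nary_f_quandle n (UNIV :: bool set) hd id"
    using assms ne by unfold_locales (auto simp: op_morphism_def hd_map bij_betw_def)
  show "shelf_morphism n (UNIV :: bool set) hd id (\<lambda>_. True)"
    using ne by (auto simp: shelf_morphism_def op_morphism_def hd_map)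
  show "\<not> nary_f_rack n (UNIV :: bool set) ((\<lambda>_. True) \<circ> hd) ((\<lambda>_. True) \<circ> id)"
  proof
    assume "nary_f_rack n (UNIV :: bool set) ((\<lambda>_. True) \<circ> hd) ((\<lambda>_. True) \<circ> id)"
    then have "bij_betw (\<lambda>x. ((\<lambda>_. True) \<circ> hd) (x # replicate (n - 1) True)) UNIV (UNIV :: bool set)"
      by (rule nary_f_rack.right_mult_bij) (simp add: tuples_def)
    then have "inj (\<lambda>x :: bool. True)"
      by (simp add: bij_betw_def)
    then have "True = False"
      by (rule injD) simp
    then show False by simp
  qed
qed

end

theory Submission
  imports Defs
begin

text \<open>
  Since \<open>\<beta>\<close> commutes with \<open>T\<close>, it can be moved through every occurrence of the operation. Both
  sides of the distributive law for \<open>\<beta> \<circ> T\<close> and \<open>\<beta> \<circ> \<alpha>\<close> contain \<open>\<beta>\<close> once outside and once on each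
  argument of the outer \<open>T\<close>. Pulling out the inner copies leaves \<open>\<beta>\<^sup>2\<close> applied to the two sides of
  the distributive law for \<open>T\<close> and \<open>\<alpha>\<close>. The twisted map \<open>\<beta> \<circ> \<alpha>\<close> is again a morphism because
  \<open>\<alpha>\<close> and \<open>\<beta>\<close> commute, and the diagonal of \<open>\<beta> \<circ> T\<close> is \<open>\<beta>\<close> after the diagonal of \<open>T\<close>.

  The right multiplications of \<open>\<beta> \<circ> T\<close> are \<open>\<beta> \<circ> R\<close> with \<open>R\<close> a right multiplication of \<open>T\<close>. As
  \<open>R\<close> is bijective, these are bijective as soon as \<open>\<beta>\<close> is. This is where bijectivity
  of \<open>\<beta>\<close> enters for racks and quandles.
\<close>

lemma op_morphism_in: "op_morphism n Q T \<phi> \<Longrightarrow> x \<in> Q \<Longrightarrow> \<phi> x \<in> Q"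
  by (auto simp: op_morphism_def)

lemma op_morphism_apply: "op_morphism n Q T \<phi> \<Longrightarrow> xs \<in> tuples Q n \<Longrightarrow> \<phi> (T xs) = T (map \<phi> xs)"
  by (simp add: op_morphism_def)

lemma map_in_tuples:
  assumes "\<And>x. x \<in> Q \<Longrightarrow> \<phi> x \<in> Q" and "xs \<in> tuples Q k"
  shows "map \<phi> xs \<in> tuples Q k"
  using assms by (auto simp: tuples_def)

lemma Cons_in_tuples:
  "k > 0 \<Longrightarrow> x \<in> Q \<Longrightarrow> us \<in> tuples Q (k - 1) \<Longrightarrow> x # us \<in> tuples Q k"
  by (auto simp: tuples_def)

text \<open>
  Commutation of \<open>\<phi>\<close> and \<open>\<psi>\<close> is needed because the operation itself is twisted: moving
  \<open>\<psi> \<circ> \<phi>\<close> past \<open>\<psi> \<circ> T\<close> exchanges the two maps.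
\<close>
lemma op_morphism_twist:
  assumes \<phi>: "op_morphism n Q T \<phi>" and \<psi>: "op_morphism n Q T \<psi>"
    and comm: "\<And>x. x \<in> Q \<Longrightarrow> \<psi> (\<phi> x) = \<phi> (\<psi> x)"
  shows "op_morphism n Q (\<psi> \<circ> T) (\<psi> \<circ> \<phi>)"
proof -
  have "\<psi> (\<phi> (\<psi> (T xs))) = \<psi> (T (map (\<psi> \<circ> \<phi>) xs))" if xs: "xs \<in> tuples Q n" for xs
  proof -
    have "\<phi> (\<psi> (T xs)) = \<phi> (T (map \<psi> xs))"
      using \<psi> xs by (simp add: op_morphism_apply)
    also have "\<dots> = T (map \<phi> (map \<psi> xs))"
      by (rule op_morphism_apply[OF \<phi> map_in_tuples[OF op_morphism_in[OF \<psi>] xs]])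
    also have "map \<phi> (map \<psi> xs) = map (\<psi> \<circ> \<phi>) xs"
      using xs comm by (auto simp: tuples_def)
    finally show ?thesis by simp
  qed
  moreover have "\<psi> (\<phi> x) \<in> Q" if "x \<in> Q" for x
    using op_morphism_in[OF \<psi> op_morphism_in[OF \<phi> that]] .
  ultimately show ?thesis
    unfolding op_morphism_def by auto
qed

lemma nary_f_shelf_twist:
  assumes "n > 0" and "nary_f_shelf n Q T \<alpha>" and morph: "shelf_morphism n Q T \<alpha> \<beta>"
  shows "nary_f_shelf n Q (\<beta> \<circ> T) (\<beta> \<circ> \<alpha>)"
proof -
  interpret nary_f_shelf n Q T \<alpha> by fact
  have \<beta>: "op_morphism n Q T \<beta>" and comm: "\<And>x. x \<in> Q \<Longrightarrow> \<beta> (\<alpha> x) = \<alpha> (\<beta> x)"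
    using morph by (auto simp: shelf_morphism_def)
  note \<beta>_in = op_morphism_in[OF \<beta>] and \<alpha>_in = op_morphism_in[OF twist_morphism]
  show ?thesis
  proof
    show "(\<beta> \<circ> T) xs \<in> Q" if "xs \<in> tuples Q n" for xs
      using that by (simp add: \<beta>_in op_closed)
    show "op_morphism n Q (\<beta> \<circ> T) (\<beta> \<circ> \<alpha>)"
      using twist_morphism \<beta> comm by (rule op_morphism_twist)
    show "(\<beta> \<circ> T) ((\<beta> \<circ> T) xs # map (\<beta> \<circ> \<alpha>) us) = (\<beta> \<circ> T) (map (\<lambda>x. (\<beta> \<circ> T) (x # us)) xs)"
      if xs: "xs \<in> tuples Q n" and us: "us \<in> tuples Q (n - 1)" for xs us
    proof -
      have left: "T xs # map \<alpha> us \<in> tuples Q n"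
        using \<open>n > 0\<close> op_closed[OF xs] map_in_tuples[OF \<alpha>_in us] by (rule Cons_in_tuples)
      have "T (x # us) \<in> Q" if "x \<in> Q" for x
        using op_closed Cons_in_tuples[OF \<open>n > 0\<close> that us] .
      then have right: "map (\<lambda>x. T (x # us)) xs \<in> tuples Q n"
        using xs by (rule map_in_tuples)
      have "T ((\<beta> \<circ> T) xs # map (\<beta> \<circ> \<alpha>) us) = T (map \<beta> (T xs # map \<alpha> us))"
        by simp
      also have "\<dots> = \<beta> (T (T xs # map \<alpha> us))"
        by (rule op_morphism_apply[OF \<beta> left, symmetric])
      also have "\<dots> = \<beta> (T (map (\<lambda>x. T (x # us)) xs))"
        by (simp only: f_distributive[OF xs us])
      also have "\<dots> = T (map \<beta> (map (\<lambda>x. T (x # us)) xs))"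
        by (rule op_morphism_apply[OF \<beta> right])
      also have "\<dots> = T (map (\<lambda>x. (\<beta> \<circ> T) (x # us)) xs)"
        by (simp add: comp_def)
      finally show ?thesis by simp
    qed
  qed
qed

lemma nary_f_rack_twist:
  assumes "n > 0" and "nary_f_rack n Q T \<alpha>" and "shelf_morphism n Q T \<alpha> \<beta>"
    and bij: "bij_betw \<beta> Q Q"
  shows "nary_f_rack n Q (\<beta> \<circ> T) (\<beta> \<circ> \<alpha>)"
proof -
  interpret nary_f_rack n Q T \<alpha> by fact
  interpret twisted: nary_f_shelf n Q "\<beta> \<circ> T" "\<beta> \<circ> \<alpha>"
    using assms(1) nary_f_shelf_axioms assms(3) by (rule nary_f_shelf_twist)
  show ?thesis
  proof
    show "bij_betw (\<lambda>x. (\<beta> \<circ> T) (x # as)) Q Q" if "as \<in> tuples Q (n - 1)" for as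
      using bij_betw_trans[OF right_mult_bij[OF that] bij] by (simp add: comp_def)
  qed
qed

lemma nary_f_quandle_twist:
  assumes "n > 0" and "nary_f_quandle n Q T \<alpha>" and "shelf_morphism n Q T \<alpha> \<beta>"
    and "bij_betw \<beta> Q Q"
  shows "nary_f_quandle n Q (\<beta> \<circ> T) (\<beta> \<circ> \<alpha>)"
proof -
  interpret nary_f_quandle n Q T \<alpha> by fact
  interpret twisted: nary_f_rack n Q "\<beta> \<circ> T" "\<beta> \<circ> \<alpha>"
    using assms(1) nary_f_rack_axioms assms(3,4) by (rule nary_f_rack_twist)
  show ?thesis
    by unfold_locales (simp add: diagonal)
qed

theorem proposition3p1:
  fixes n :: nat
    and Q :: "'a set"
    and T :: "'a list \<Rightarrow> 'a"
    and \<alpha> \<beta> :: "'a \<Rightarrow> 'a"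
  assumes "n \<ge> 2"
    and "shelf_morphism n Q T \<alpha> \<beta>"
  shows "(nary_f_shelf n Q T \<alpha> \<longrightarrow> nary_f_shelf n Q (\<beta> \<circ> T) (\<beta> \<circ> \<alpha>)) \<and>
         (nary_f_rack n Q T \<alpha> \<and> bij_betw \<beta> Q Q \<longrightarrow> nary_f_rack n Q (\<beta> \<circ> T) (\<beta> \<circ> \<alpha>)) \<and>
         (nary_f_quandle n Q T \<alpha> \<and> bij_betw \<beta> Q Q \<longrightarrow> nary_f_quandle n Q (\<beta> \<circ> T) (\<beta> \<circ> \<alpha>))"
proof -
  have "n > 0" using assms(1) by simp
  note twist = nary_f_shelf_twist[OF this _ assms(2)] nary_f_rack_twist[OF this _ assms(2)]
    nary_f_quandle_twist[OF this _ assms(2)]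
  show ?thesis
    by (intro conjI impI) (simp_all only: twist)
qed

end
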